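(* (Hake Theorem) Suppose $f\in\mathcal{D}'$ and $f=F'$ (distributional derivative) for some $F\in C^0(\mathbb{R})$. If $\lim_{\infty}F$ and $\lim_{-\infty}F$ exist in $\mathbb{R}$ then $f\in\mathcal{A}_C$ and $$\int_{-\infty}^\infty f=\lim_{x\to\infty}\int_0^x f+\lim_{x\to-\infty}\int_x^0 f.$$
   Context: $\mathcal{D}=C_c^\infty(\mathbb{R})$ (real-valued), $\mathcal{D}'$ is the space of distributions, $\langle T',\phi\rangle=-\langle T,\phi'\rangle$; functions are identified with distributions in the usual way. $\overline{\mathbb{R}}=[-\infty,\infty]$. $C^0(\mathbb{R})$ is the set of continuous real functions on $\mathbb{R}$, and $C^0(\overline{\mathbb{R}})$ is the set of those with real limits at $\pm\infty$, extended by $F(\pm\infty)=\lim_{\pm\infty}F$. $\mathcal{B}_C=\{F\in C^0(\overline{\mathbb{R}}): F(-\infty)=0\}$ and $\mathcal{A}_C=\{f\in\mathcal{D}': f=F' \text{ for some } F\in\mathcal{B}_C\}$. For $f\in\mathcal{A}_C$ with (unique) primitive $F\in\mathcal{B}_C$, $\int_{-\infty}^\infty f=F(\infty)$. If $f=F'$ on a bounded open interval $(a,b)$ with $F\in C^0([a,b])$ then $\int_a^b f=F(b)-F(a)$. *)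

theory Defs
  imports "HOL-Analysis.Analysis"
begin

section \<open>Test functions\<close>

definition smooth :: "(real \<Rightarrow> real) \<Rightarrow> bool" where
  "smooth \<phi> \<longleftrightarrow> (\<forall>n x. (deriv ^^ n) \<phi> field_differentiable at x)"

definition supp :: "(real \<Rightarrow> real) \<Rightarrow> real set" where
  "supp \<phi> = closure {x. \<phi> x \<noteq> 0}"

lemma higher_deriv_add:
  assumes "smooth \<phi>" "smooth \<psi>"
  shows "(deriv ^^ n) (\<lambda>x. \<phi> x + \<psi> x) = (\<lambda>x. (deriv ^^ n) \<phi> x + (deriv ^^ n) \<psi> x)"
proof (induction n)
  case (Suc n)
  then show ?case
    using assms by (auto simp: smooth_def intro!: ext deriv_add)
qed simp

lemma higher_deriv_cmult:
  assumes "smooth \<phi>"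
  shows "(deriv ^^ n) (\<lambda>x. c * \<phi> x) = (\<lambda>x. c * (deriv ^^ n) \<phi> x)"
proof (induction n)
  case (Suc n)
  then show ?case
    using assms by (auto simp: smooth_def intro!: ext deriv_cmult)
qed simp

lemma smooth_zero: "smooth (\<lambda>x. 0)"
proof -
  have "(deriv ^^ n) (\<lambda>x. 0::real) = (\<lambda>x. 0)" for n
    by (induction n) auto
  then show ?thesis
    by (simp add: smooth_def)
qed

lemma smooth_add: "smooth \<phi> \<Longrightarrow> smooth \<psi> \<Longrightarrow> smooth (\<lambda>x. \<phi> x + \<psi> x)"
  unfolding smooth_def[of "\<lambda>x. \<phi> x + \<psi> x"]
  by (auto simp: higher_deriv_add smooth_def intro!: field_differentiable_add)

lemma smooth_cmult: "smooth \<phi> \<Longrightarrow> smooth (\<lambda>x. c * \<phi> x)"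
  unfolding smooth_def[of "\<lambda>x. c * \<phi> x"]
  by (auto simp: higher_deriv_cmult smooth_def intro!: field_differentiable_mult)

lemma smooth_deriv: "smooth \<phi> \<Longrightarrow> smooth (deriv \<phi>)"
  unfolding smooth_def by (metis funpow_Suc_right o_apply)

lemma compact_supp_mono:
  assumes "compact (supp \<phi>)" "supp \<psi> \<subseteq> supp \<phi>"
  shows "compact (supp \<psi>)"
  using assms by (metis closed_closure compact_Int_closed inf.absorb_iff2 supp_def)

lemma supp_add: "supp (\<lambda>x. \<phi> x + \<psi> x) \<subseteq> supp \<phi> \<union> supp \<psi>"
  unfolding supp_def closure_Un[symmetric] by (rule closure_mono) auto

lemma supp_cmult: "supp (\<lambda>x. c * \<phi> x) \<subseteq> supp \<phi>"
  unfolding supp_def by (rule closure_mono) auto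

lemma supp_deriv: "supp (deriv \<phi>) \<subseteq> supp \<phi>"
proof -
  have "deriv \<phi> x = 0" if "x \<notin> supp \<phi>" for x
  proof -
    have "open (- supp \<phi>)"
      unfolding supp_def by (rule open_Compl) (rule closed_closure)
    then have "\<forall>\<^sub>F y in nhds x. y \<in> - supp \<phi>"
      using that by (intro eventually_nhds_in_open) auto
    then have "\<forall>\<^sub>F y in nhds x. \<phi> y = 0"
      by eventually_elim (use closure_subset[of "{x. \<phi> x \<noteq> 0}"] in \<open>auto simp: supp_def\<close>)
    then have "deriv \<phi> x = deriv (\<lambda>x. 0) x"
      by (intro deriv_cong_ev) auto
    then show ?thesis
      by simp
  qed
  then have "{x. deriv \<phi> x \<noteq> 0} \<subseteq> supp \<phi>"
    by blast
  then show ?thesis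
    by (simp add: supp_def closure_minimal)
qed

typedef test_fun = "{\<phi>. smooth \<phi> \<and> compact (supp \<phi>)}"
  morphisms fun_of Test_fun
  by (rule exI[of _ "\<lambda>x. 0"]) (simp add: smooth_zero supp_def)

setup_lifting type_definition_test_fun

instantiation test_fun :: real_vector
begin

lift_definition zero_test_fun :: test_fun is "\<lambda>x. 0"
  by (simp add: smooth_zero supp_def)

lift_definition plus_test_fun :: "test_fun \<Rightarrow> test_fun \<Rightarrow> test_fun" is "\<lambda>\<phi> \<psi> x. \<phi> x + \<psi> x"
proof -
  fix \<phi> \<psi> :: "real \<Rightarrow> real"
  assume *: "smooth \<phi> \<and> compact (supp \<phi>)" "smooth \<psi> \<and> compact (supp \<psi>)"
  have "compact ((supp \<phi> \<union> supp \<psi>) \<inter> supp (\<lambda>x. \<phi> x + \<psi> x))"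
    using * by (intro compact_Int_closed compact_Un) (auto simp: supp_def)
  then show "smooth (\<lambda>x. \<phi> x + \<psi> x) \<and> compact (supp (\<lambda>x. \<phi> x + \<psi> x))"
    using * smooth_add supp_add by (metis inf.absorb_iff2)
qed

lift_definition scaleR_test_fun :: "real \<Rightarrow> test_fun \<Rightarrow> test_fun" is "\<lambda>c \<phi> x. c * \<phi> x"
  using smooth_cmult compact_supp_mono supp_cmult by blast

lift_definition uminus_test_fun :: "test_fun \<Rightarrow> test_fun" is "\<lambda>\<phi> x. - 1 * \<phi> x"
  using smooth_cmult compact_supp_mono supp_cmult by blast

definition minus_test_fun :: "test_fun \<Rightarrow> test_fun \<Rightarrow> test_fun" where
  "minus_test_fun \<phi> \<psi> = \<phi> + - \<psi>"

instance
  by standard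
    (simp_all add: minus_test_fun_def, (transfer, simp add: algebra_simps fun_eq_iff)+)

end

lift_definition test_deriv :: "test_fun \<Rightarrow> test_fun" is deriv
  using smooth_deriv compact_supp_mono supp_deriv by blast

text \<open>Convergence in the usual topology of the test function space.\<close>

definition test_converges :: "(nat \<Rightarrow> test_fun) \<Rightarrow> test_fun \<Rightarrow> bool" where
  "test_converges \<Phi> \<phi> \<longleftrightarrow>
    (\<exists>K. compact K \<and> (\<forall>n. supp (fun_of (\<Phi> n)) \<subseteq> K)) \<and>
    (\<forall>m. uniform_limit UNIV (\<lambda>n. (deriv ^^ m) (fun_of (\<Phi> n))) ((deriv ^^ m) (fun_of \<phi>)) sequentially)"

section \<open>Distributions\<close>

text \<open>For linear functionals on test functions, continuity is the same as sequential continuity.\<close>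

definition distributions :: "(test_fun \<Rightarrow> real) set" where
  "distributions = {T. linear T \<and>
    (\<forall>\<Phi> \<phi>. test_converges \<Phi> \<phi> \<longrightarrow> (\<lambda>n. T (\<Phi> n)) \<longlonglongrightarrow> T \<phi>)}"

definition dist_deriv :: "(test_fun \<Rightarrow> real) \<Rightarrow> test_fun \<Rightarrow> real" where
  "dist_deriv T \<phi> = - T (test_deriv \<phi>)"

text \<open>The distribution on the open set \<open>U\<close> given by a function \<open>F\<close> that is locally integrable
  on \<open>U\<close>; only its values at test functions supported in \<open>U\<close> are meaningful.\<close>

definition dist_of :: "real set \<Rightarrow> (real \<Rightarrow> real) \<Rightarrow> test_fun \<Rightarrow> real" where
  "dist_of U F \<phi> = (LINT x:U|lborel. F x * fun_of \<phi> x)"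

definition dist_eq_on :: "real set \<Rightarrow> (test_fun \<Rightarrow> real) \<Rightarrow> (test_fun \<Rightarrow> real) \<Rightarrow> bool" where
  "dist_eq_on U S T \<longleftrightarrow> (\<forall>\<phi>. supp (fun_of \<phi>) \<subseteq> U \<longrightarrow> S \<phi> = T \<phi>)"

section \<open>The continuous primitive integral\<close>

definition C0 :: "(real \<Rightarrow> real) set" where
  "C0 = {F. continuous_on UNIV F}"

definition C0_ext :: "(real \<Rightarrow> real) set" where
  "C0_ext = {F \<in> C0. (\<exists>l. (F \<longlongrightarrow> l) at_top) \<and> (\<exists>l. (F \<longlongrightarrow> l) at_bot)}"

definition ext_val :: "(real \<Rightarrow> real) \<Rightarrow> ereal \<Rightarrow> real" where
  "ext_val F x = (if x = \<infinity> then Lim at_top F else if x = - \<infinity> then Lim at_bot F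
    else F (real_of_ereal x))"

definition B_C :: "(real \<Rightarrow> real) set" where
  "B_C = {F \<in> C0_ext. ext_val F (-\<infinity>) = 0}"

definition A_C :: "(test_fun \<Rightarrow> real) set" where
  "A_C = {f \<in> distributions. \<exists>F\<in>B_C. f = dist_deriv (dist_of UNIV F)}"

definition primitive :: "(test_fun \<Rightarrow> real) \<Rightarrow> real \<Rightarrow> real" where
  "primitive f = (THE F. F \<in> B_C \<and> f = dist_deriv (dist_of UNIV F))"

definition integral_line :: "(test_fun \<Rightarrow> real) \<Rightarrow> real" where
  "integral_line f = ext_val (primitive f) \<infinity>"

text \<open>Only meaningful for \<open>a < b\<close>. The primitive on \<open>(a, b)\<close> is unique up to a constant,
  so the value does not depend on its choice.\<close>

definition integral_interval :: "real \<Rightarrow> real \<Rightarrow> (test_fun \<Rightarrow> real) \<Rightarrow> real" where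
  "integral_interval a b f = (THE I. \<exists>F. continuous_on {a..b} F \<and>
    dist_eq_on {a<..<b} f (dist_deriv (dist_of {a<..<b} F)) \<and> I = F b - F a)"

end

theory Submission
  imports Defs
begin

text \<open>The heart of the matter is that primitives are unique up to a constant, which is what makes
  both kinds of integral well defined. If a continuous \<open>H\<close> annihilates all \<open>\<phi>'\<close> and
  \<open>H c < m < H d\<close>, take for \<open>\<phi>\<close> the difference of a smooth step at \<open>c\<close> and the same step at \<open>d\<close>.
  Then \<open>\<phi>'\<close> is a positive bump near \<open>c\<close> and a negative one near \<open>d\<close>, so \<open>(m - H) \<phi>'\<close> is
  nonnegative and positive near \<open>c\<close>, although its integral is \<open>0\<close>.\<close>

section \<open>Smooth functions\<close>

lemma smooth_imp_differentiable: "smooth f \<Longrightarrow> f field_differentiable at x"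
  unfolding smooth_def by (metis funpow_0)

lemma smooth_has_deriv: "smooth f \<Longrightarrow> (f has_real_derivative deriv f x) (at x)"
  by (rule field_differentiable_derivI) (rule smooth_imp_differentiable)

lemma smooth_imp_continuous_on: "smooth f \<Longrightarrow> continuous_on S f"
  by (meson continuous_at_imp_continuous_on field_differentiable_imp_continuous_at
      smooth_imp_differentiable)

lemma smooth_antiderivative:
  assumes "\<And>x. (f has_real_derivative g x) (at x)" and "smooth g"
  shows "smooth f"
proof -
  have "deriv f = g"
    using assms(1) by (auto intro: DERIV_imp_deriv)
  then have "(deriv ^^ n) f field_differentiable at x" for n x
    using assms by (cases n)
      (auto simp: smooth_def funpow_Suc_right field_differentiable_def simp del: funpow.simps)
  then show ?thesis
    by (simp add: smooth_def)
qed

text \<open>Induction on the order, for all \<open>f\<close> and \<open>g\<close> at once: by the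
  product rule the derivative of \<open>f g\<close> is \<open>f g' + f' g\<close>, a sum of products
  of smooth functions, to each of which the induction hypothesis applies.\<close>

lemma smooth_mult:
  assumes "smooth f" "smooth g"
  shows "smooth (\<lambda>x. f x * g x)"
proof -
  \<comment> \<open>\<open>smooth_add\<close> asks for summands smooth of every order, while the
    induction below controls only the orders up to \<open>n\<close>; hence this version of finite
    order.\<close>
  have sum: "\<forall>k\<le>n. \<forall>x. (deriv ^^ k) (\<lambda>x. u x + v x) field_differentiable at x \<and>
      (deriv ^^ k) (\<lambda>x. u x + v x) = (\<lambda>x. (deriv ^^ k) u x + (deriv ^^ k) v x)"
    if "\<forall>k\<le>n. \<forall>x. (deriv ^^ k) u field_differentiable at x"
      "\<forall>k\<le>n. \<forall>x. (deriv ^^ k) v field_differentiable at x" for n and u v :: "real \<Rightarrow> real"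
  proof -
    have "(deriv ^^ k) (\<lambda>x. u x + v x) = (\<lambda>x. (deriv ^^ k) u x + (deriv ^^ k) v x)"
      if "k \<le> n" for k
      using that
    proof (induction k)
      case (Suc k)
      then show ?case
        using \<open>\<forall>k\<le>n. \<forall>x. (deriv ^^ k) u field_differentiable at x\<close>
          \<open>\<forall>k\<le>n. \<forall>x. (deriv ^^ k) v field_differentiable at x\<close>
        by (auto intro!: ext deriv_add)
    qed simp
    with that show ?thesis
      by (auto intro!: field_differentiable_add)
  qed
  have "\<forall>k\<le>n. \<forall>x. (deriv ^^ k) (\<lambda>x. f x * g x) field_differentiable at x" for n
    using assms
  proof (induction n arbitrary: f g)
    case 0
    then have "(\<lambda>x. f x * g x) field_differentiable at x" for x
      by (intro field_differentiable_mult smooth_imp_differentiable)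
    then show ?case
      by simp
  next
    case (Suc n)
    have d: "deriv (\<lambda>x. f x * g x) = (\<lambda>x. f x * deriv g x + deriv f x * g x)"
      using Suc.prems by (auto intro!: ext deriv_mult smooth_imp_differentiable)
    have "\<forall>k\<le>n. \<forall>x. (deriv ^^ k) (deriv (\<lambda>x. f x * g x)) field_differentiable at x"
      unfolding d using sum[OF Suc.IH Suc.IH] Suc.prems smooth_deriv by blast
    moreover have "(\<lambda>x. f x * g x) field_differentiable at x" for x
      using Suc.prems by (intro field_differentiable_mult smooth_imp_differentiable)
    ultimately show ?case
      by (auto simp: funpow_Suc_right less_Suc_eq_0_disj simp flip: less_Suc_eq_le
          simp del: funpow.simps)
  qed
  then show ?thesis
    by (auto simp: smooth_def)
qed

lemma smooth_compose_affine:
  assumes "smooth f"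
  shows "smooth (\<lambda>x. f (m * x + c))"
proof -
  have D: "((\<lambda>x. (deriv ^^ n) f (m * x + c)) has_real_derivative m * (deriv ^^ Suc n) f (m * x + c))
      (at x)" for n x
  proof -
    have "((deriv ^^ n) f has_real_derivative (deriv ^^ Suc n) f (m * x + c)) (at (m * x + c))"
      using assms by (auto simp: smooth_def intro: field_differentiable_derivI)
    then have "((\<lambda>x. (deriv ^^ n) f (m * x + c)) has_real_derivative
        (deriv ^^ Suc n) f (m * x + c) * m) (at x)"
      by (rule DERIV_chain2) (auto intro!: derivative_eq_intros)
    then show ?thesis
      by (simp add: mult.commute)
  qed
  \<comment> \<open>Each differentiation brings out one more factor \<open>m\<close>.\<close>
  have D': "((\<lambda>x. m ^ n * (deriv ^^ n) f (m * x + c)) has_real_derivative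
      m ^ Suc n * (deriv ^^ Suc n) f (m * x + c)) (at x)" for n x
    using DERIV_cmult[OF D, of "m ^ n"] by (simp add: mult.assoc mult.left_commute)
  have "(deriv ^^ n) (\<lambda>x. f (m * x + c)) = (\<lambda>x. m ^ n * (deriv ^^ n) f (m * x + c))" for n
  proof (induction n)
    case (Suc n)
    then show ?case
      using D'[of n] by (auto intro!: ext DERIV_imp_deriv)
  qed simp
  then show ?thesis
    using D' by (auto simp: smooth_def field_differentiable_def)
qed

section \<open>A smooth step function\<close>

text \<open>For \<open>p = 1\<close> this is the classical smooth function that is not analytic at
  \<open>0\<close>. The polynomial factor makes the family closed under differentiation.\<close>

definition flat :: "real poly \<Rightarrow> real \<Rightarrow> real" where
  "flat p x = (if x \<le> 0 then 0 else poly p (1 / x) * exp (- (1 / x)))"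

lemma poly_times_exp_minus_tendsto_0:
  "((\<lambda>y::real. poly p y * exp (- y)) \<longlongrightarrow> 0) at_top"
proof -
  have "((\<lambda>y::real. \<Sum>i\<le>degree p. coeff p i * (y ^ i / exp y)) \<longlongrightarrow> (\<Sum>i\<le>degree p. coeff p i * 0)) at_top"
    by (intro tendsto_intros tendsto_power_div_exp_0)
  then show ?thesis
    by (simp add: poly_altdef sum_distrib_right exp_minus divide_inverse mult.assoc)
qed

text \<open>With \<open>y = 1 / x\<close> one has \<open>d/dx = - y^2 d/dy\<close>, which turns
  \<open>p(y) exp(-y)\<close> into \<open>y^2 (p - p')(y) exp(-y)\<close>; the factor
  \<open>[:0, 0, 1:]\<close> is \<open>y^2\<close>. At \<open>0\<close> both one-sided difference
  quotients tend to \<open>0\<close>, the right one because the exponential beats every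
  polynomial.\<close>

lemma flat_has_deriv:
  "(flat p has_real_derivative flat ([:0, 0, 1:] * (p - pderiv p)) x) (at x)"
proof (cases x "0::real" rule: linorder_cases)
  case less
  have "((\<lambda>x. 0) has_real_derivative 0) (at x)"
    by simp
  moreover have "\<forall>\<^sub>F y in nhds x. flat p y = 0"
    using eventually_nhds_in_open[of "{..<0}" x] less
    by (auto simp: flat_def elim!: eventually_mono)
  ultimately show ?thesis
    using less by (simp add: flat_def DERIV_cong_ev)
next
  case greater
  have "((\<lambda>x. poly p (1 / x) * exp (- (1 / x))) has_real_derivative
      flat ([:0, 0, 1:] * (p - pderiv p)) x) (at x)"
    using greater
    by (auto intro!: derivative_eq_intros DERIV_chain2[OF poly_DERIV]
        simp: flat_def field_simps power2_eq_square)
  moreover have "\<forall>\<^sub>F y in nhds x. flat p y = poly p (1 / y) * exp (- (1 / y))"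
    using eventually_nhds_in_open[of "{0<..}" x] greater
    by (auto simp: flat_def elim!: eventually_mono)
  ultimately show ?thesis
    by (simp add: DERIV_cong_ev)
next
  case equal
  have "((\<lambda>h. flat p h / h) \<longlongrightarrow> 0) (at_right 0)"
  proof -
    \<comment> \<open>In \<open>y = 1 / h\<close> the quotient is \<open>y p(y) exp(-y)\<close>,
      again a polynomial times \<open>exp(-y)\<close>.\<close>
    have "((\<lambda>h. poly ([:0, 1:] * p) (inverse h) * exp (- inverse h)) \<longlongrightarrow> 0) (at_right 0)"
      by (rule filterlim_compose[OF poly_times_exp_minus_tendsto_0 filterlim_inverse_at_top_right])
    moreover have "\<forall>\<^sub>F h in at_right 0. poly ([:0, 1:] * p) (inverse h) * exp (- inverse h)
        = flat p h / h"
      by (auto simp: eventually_at_filter flat_def divide_inverse)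
    ultimately show ?thesis
      by (rule Lim_transform_eventually)
  qed
  moreover have "((\<lambda>h. flat p h / h) \<longlongrightarrow> 0) (at_left 0)"
    by (rule Lim_transform_eventually[OF tendsto_const])
      (auto simp: eventually_at_filter flat_def)
  ultimately have "((\<lambda>h. flat p h / h) \<longlongrightarrow> 0) (at 0)"
    by (rule filterlim_split_at[rotated])
  then show ?thesis
    using equal by (simp add: DERIV_def flat_def)
qed

lemma smooth_flat: "smooth (flat p)"
proof -
  have "\<exists>q. (deriv ^^ n) (flat p) = flat q" for n
  proof (induction n)
    case (Suc n)
    then obtain q where "(deriv ^^ n) (flat p) = flat q"
      by blast
    moreover have "deriv (flat q) = flat ([:0, 0, 1:] * (q - pderiv q))"
      using flat_has_deriv by (auto intro!: ext DERIV_imp_deriv)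
    ultimately show ?case
      by auto
  qed auto
  then show ?thesis
    unfolding smooth_def by (metis flat_has_deriv field_differentiable_def)
qed

text \<open>The step is an antiderivative of a smooth bump on \<open>(-e, e)\<close>: it increases
  there and is constant on each of the two remaining rays.\<close>

lemma smooth_step_exists:
  fixes e :: real
  assumes "e > 0"
  obtains \<Psi> where "smooth \<Psi>" "\<And>y z. y \<le> - e \<Longrightarrow> z \<le> - e \<Longrightarrow> \<Psi> y = \<Psi> z"
    "\<And>y z. e \<le> y \<Longrightarrow> e \<le> z \<Longrightarrow> \<Psi> y = \<Psi> z" "\<And>y. deriv \<Psi> y \<ge> 0"
    "\<And>y. deriv \<Psi> y > 0 \<longleftrightarrow> \<bar>y\<bar> < e"
proof -
  \<comment> \<open>The first factor is positive exactly for \<open>y > - e\<close>, the second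
    exactly for \<open>y < e\<close>. The coefficients \<open>1\<close> and \<open>- 1\<close> are
    written out to fit \<open>smooth_compose_affine\<close>.\<close>
  define \<psi> where "\<psi> y = flat 1 (1 * y + e) * flat 1 (- 1 * y + e)" for y
  have smooth: "smooth \<psi>"
    unfolding \<psi>_def by (intro smooth_mult smooth_compose_affine smooth_flat)
  have pos: "\<psi> y > 0 \<longleftrightarrow> \<bar>y\<bar> < e" and nonneg: "\<psi> y \<ge> 0" for y
    by (auto simp: \<psi>_def flat_def zero_less_mult_iff)
  have zero: "\<psi> y = 0" if "e \<le> \<bar>y\<bar>" for y
    using pos[of y] nonneg[of y] that by linarith
  have "\<exists>\<Psi>. \<forall>x. - \<infinity> < ereal x \<longrightarrow> ereal x < \<infinity> \<longrightarrow> (\<Psi> has_vector_derivative \<psi> x) (at x)"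
    using smooth by (intro einterval_antiderivative)
      (auto intro: field_differentiable_imp_continuous_at smooth_imp_differentiable)
  then obtain \<Psi> where \<Psi>: "\<And>x. (\<Psi> has_real_derivative \<psi> x) (at x)"
    by (auto simp: has_real_derivative_iff_has_vector_derivative)
  then have d: "deriv \<Psi> = \<psi>"
    by (auto intro: DERIV_imp_deriv)
  show thesis
  proof
    show "smooth \<Psi>"
      using \<Psi> smooth by (rule smooth_antiderivative)
    have const: "\<Psi> y = \<Psi> z" if "convex S" "\<And>x. x \<in> S \<Longrightarrow> e \<le> \<bar>x\<bar>" "y \<in> S" "z \<in> S" for S y z
    proof -
      have "(\<Psi> has_real_derivative 0) (at x within S)" if "x \<in> S" for x
        using \<Psi>[of x] zero[of x] \<open>\<And>x. x \<in> S \<Longrightarrow> e \<le> \<bar>x\<bar>\<close>[OF that]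
        by (simp add: has_field_derivative_at_within)
      then show ?thesis
        using has_field_derivative_zero_constant[OF that(1), of \<Psi>] that(3,4) by metis
    qed
    show "\<Psi> y = \<Psi> z" if "y \<le> - e" "z \<le> - e" for y z
      using that by (intro const[of "{..- e}"]) auto
    show "\<Psi> y = \<Psi> z" if "e \<le> y" "e \<le> z" for y z
      using that by (intro const[of "{e..}"]) auto
  qed (use pos nonneg d in auto)
qed

section \<open>Pairing functions with test functions\<close>

lemma fun_of_eq_0: "x \<notin> supp (fun_of \<phi>) \<Longrightarrow> fun_of \<phi> x = 0"
  using closure_subset[of "{x. fun_of \<phi> x \<noteq> 0}"] by (auto simp: supp_def)

lemma supp_test_deriv: "supp (fun_of (test_deriv \<phi>)) \<subseteq> supp (fun_of \<phi>)"
  by (simp add: test_deriv.rep_eq supp_deriv)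

lemma smooth_fun_of: "smooth (fun_of \<phi>)" and compact_supp_fun_of: "compact (supp (fun_of \<phi>))"
  using fun_of[of \<phi>] by auto

text \<open>Removes \<open>U\<close> from the pairing, so that distributions on an interval and on
  the line become comparable.\<close>

lemma dist_of_eq_LINT:
  assumes "supp (fun_of \<phi>) \<subseteq> U"
  shows "dist_of U F \<phi> = (LINT x|lborel. F x * fun_of \<phi> x)"
  unfolding dist_of_def set_lebesgue_integral_def
  using assms fun_of_eq_0[of _ \<phi>] by (intro Bochner_Integration.integral_cong) (auto simp: indicator_def)

text \<open>The product is continuous on the compact support and vanishes off it, so the values of
  \<open>F\<close> outside \<open>U\<close> do not matter.\<close>

lemma integrable_times_test_fun:
  assumes "continuous_on U F" "supp (fun_of \<phi>) \<subseteq> U"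
  shows "integrable lborel (\<lambda>x. F x * fun_of \<phi> x)"
proof -
  have "continuous_on (supp (fun_of \<phi>)) (\<lambda>x. F x * fun_of \<phi> x)"
    using assms
    by (auto intro!: continuous_on_mult smooth_imp_continuous_on[OF smooth_fun_of]
        intro: continuous_on_subset)
  then have "integrable lborel (\<lambda>x. indicator (supp (fun_of \<phi>)) x *\<^sub>R (F x * fun_of \<phi> x))"
    by (rule borel_integrable_compact[OF compact_supp_fun_of])
  moreover have "indicator (supp (fun_of \<phi>)) x *\<^sub>R (F x * fun_of \<phi> x) = F x * fun_of \<phi> x" for x
    using fun_of_eq_0[of x \<phi>] by (auto simp: indicator_def)
  ultimately show ?thesis
    by (simp only:)
qed

lemma LINT_test_deriv: "(LINT x|lborel. fun_of (test_deriv \<phi>) x) = 0"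
proof -
  obtain r where r: "r > 0" "\<And>x. x \<in> supp (fun_of \<phi>) \<Longrightarrow> \<bar>x\<bar> \<le> r"
    using compact_imp_bounded[OF compact_supp_fun_of[of \<phi>]] by (auto simp: bounded_pos)
  \<comment> \<open>The support may reach \<open>r\<close> or \<open>- r\<close>; with
    \<open>r + 1\<close> the endpoints lie outside it, so both boundary terms vanish.\<close>
  have "(LINT x|lborel. fun_of (test_deriv \<phi>) x)
      = (LINT x|lborel. indicator {- (r + 1)..r + 1} x *\<^sub>R deriv (fun_of \<phi>) x)"
    using r supp_test_deriv[of \<phi>] fun_of_eq_0[of _ "test_deriv \<phi>"]
    by (intro Bochner_Integration.integral_cong)
      (force simp: indicator_def test_deriv.rep_eq)+
  also have "\<dots> = fun_of \<phi> (r + 1) - fun_of \<phi> (- (r + 1))"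
    using r(1)
    by (intro integral_FTC_Icc smooth_imp_continuous_on smooth_deriv smooth_fun_of)
      (auto simp: smooth_has_deriv[OF smooth_fun_of] has_field_derivative_at_within
        simp flip: has_real_derivative_iff_has_vector_derivative)
  also have "\<dots> = 0"
    using r fun_of_eq_0[of "r + 1" \<phi>] fun_of_eq_0[of "- (r + 1)" \<phi>] by force
  finally show ?thesis .
qed

section \<open>Uniqueness of primitives\<close>

text \<open>Openness leaves room for the two bumps inside \<open>U\<close>; the interval property
  keeps the plateau between \<open>c\<close> and \<open>d\<close> inside \<open>U\<close> as
  well.\<close>

lemma du_Bois_Reymond:
  fixes H :: "real \<Rightarrow> real"
  assumes "open U" "is_interval U" "continuous_on U H"
    and int0: "\<And>\<phi>. supp (fun_of \<phi>) \<subseteq> U \<Longrightarrow> (LINT x|lborel. H x * fun_of (test_deriv \<phi>) x) = 0"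
  shows "H constant_on U"
proof -
  have False if cd: "c \<in> U" "d \<in> U" "H c < H d" for c d
  proof -
    define m where "m = (H c + H d) / 2"
    have m: "H c < m" "m < H d"
      using cd by (auto simp: m_def)
    have cont: "isCont H c" "isCont H d"
      using assms(1,3) cd by (auto simp: continuous_on_eq_continuous_at)
    have "\<forall>\<^sub>F x in nhds c. x \<in> U \<and> H x < m"
      using cont m cd assms(1) order_tendstoD(2)[of H "H c" "nhds c" m]
      by (auto intro!: eventually_conj eventually_nhds_in_open simp: isCont_def tendsto_at_iff_tendsto_nhds)
    then obtain e1 where e1: "e1 > 0" "\<And>x. dist x c < e1 \<Longrightarrow> x \<in> U \<and> H x < m"
      by (auto simp: eventually_nhds_metric)
    have "\<forall>\<^sub>F x in nhds d. x \<in> U \<and> m < H x"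
      using cont m cd assms(1) order_tendstoD(1)[of H "H d" "nhds d" m]
      by (auto intro!: eventually_conj eventually_nhds_in_open simp: isCont_def tendsto_at_iff_tendsto_nhds)
    then obtain e2 where e2: "e2 > 0" "\<And>x. dist x d < e2 \<Longrightarrow> x \<in> U \<and> m < H x"
      by (auto simp: eventually_nhds_metric)
    \<comment> \<open>Strictly below \<open>e1\<close> and \<open>e2\<close>, so that even the
      points \<open>c - e\<close>, \<open>c + e\<close>, \<open>d - e\<close> and
      \<open>d + e\<close> lie in \<open>U\<close>.\<close>
    define e where "e = min e1 e2 / 2"
    have e: "e > 0" "e < e1" "e < e2"
      using e1(1) e2(1) by (auto simp: e_def min_def)
    obtain \<Psi> where \<Psi>: "smooth \<Psi>" "\<And>y z. y \<le> - e \<Longrightarrow> z \<le> - e \<Longrightarrow> \<Psi> y = \<Psi> z"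
      "\<And>y z. e \<le> y \<Longrightarrow> e \<le> z \<Longrightarrow> \<Psi> y = \<Psi> z" "\<And>y. deriv \<Psi> y \<ge> 0"
      "\<And>y. deriv \<Psi> y > 0 \<longleftrightarrow> \<bar>y\<bar> < e"
      using smooth_step_exists[OF e(1)] by blast
    define \<eta> where "\<eta> x = \<Psi> (1 * x + - c) + - 1 * \<Psi> (1 * x + - d)" for x
    have smooth: "smooth \<eta>"
      unfolding \<eta>_def by (intro smooth_add smooth_cmult smooth_compose_affine \<Psi>(1))
    \<comment> \<open>Either of \<open>c\<close> and \<open>d\<close> may be the smaller. Outside
      \<open>?I\<close> both shifted arguments lie on the same constant ray of the step, so the two
      steps cancel.\<close>
    let ?I = "{min c d - e..max c d + e}"
    have "\<eta> x = 0" if "x \<notin> ?I" for x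
      using that \<Psi>(2)[of "x - c" "x - d"] \<Psi>(3)[of "x - c" "x - d"]
      by (auto simp: \<eta>_def min_def max_def split: if_splits)
    then have "{x. \<eta> x \<noteq> 0} \<subseteq> ?I"
      by blast
    then have "supp \<eta> \<subseteq> ?I"
      unfolding supp_def by (intro closure_minimal) auto
    moreover have "min c d - e \<in> U" "max c d + e \<in> U"
      using e1(2)[of "c - e"] e1(2)[of "c + e"] e2(2)[of "d - e"] e2(2)[of "d + e"] e
      by (auto simp: dist_real_def min_def max_def)
    then have "?I \<subseteq> U"
      using assms(2) by (meson atLeastAtMost_iff is_interval_1 subsetI)
    ultimately have supp: "supp \<eta> \<subseteq> U"
      by blast
    have "compact (supp \<eta>)"
      using \<open>supp \<eta> \<subseteq> ?I\<close>
      by (metis bounded_closed_interval bounded_subset closed_closure compact_eq_bounded_closed supp_def)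
    define \<phi> where "\<phi> = Test_fun \<eta>"
    have \<phi>: "fun_of \<phi> = \<eta>"
      using smooth \<open>compact (supp \<eta>)\<close> by (simp add: \<phi>_def Test_fun_inverse)
    define K where "K x = (m - H x) * fun_of (test_deriv \<phi>) x" for x
    have deriv_\<eta>: "deriv \<eta> x = deriv \<Psi> (x - c) - deriv \<Psi> (x - d)" for x
      unfolding \<eta>_def
      by (rule DERIV_imp_deriv)
        (auto intro!: derivative_eq_intros DERIV_chain2[OF smooth_has_deriv[OF \<Psi>(1)]])
    \<comment> \<open>One term per bump: \<open>H < m\<close> wherever the first bump lives and
      \<open>H > m\<close> wherever the second does, so neither term is ever negative.\<close>
    have K: "K x = (m - H x) * deriv \<Psi> (x - c) + (H x - m) * deriv \<Psi> (x - d)" for x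
      by (simp add: K_def test_deriv.rep_eq \<phi> deriv_\<eta> algebra_simps)
    have K1: "(m - H x) * deriv \<Psi> (x - c) \<ge> 0" for x
      using \<Psi>(4,5)[of "x - c"] e1(2)[of x] e by (cases "\<bar>x - c\<bar> < e") (auto simp: dist_real_def)
    have K2: "(H x - m) * deriv \<Psi> (x - d) \<ge> 0" for x
      using \<Psi>(4,5)[of "x - d"] e2(2)[of x] e by (cases "\<bar>x - d\<bar> < e") (auto simp: dist_real_def)
    have K_pos: "K x > 0" if "x \<in> {c - e<..<c + e}" for x
    proof -
      have "H x < m" "deriv \<Psi> (x - c) > 0"
        using that \<Psi>(5)[of "x - c"] e1(2)[of x] e by (auto simp: dist_real_def)
      then show ?thesis
        using K2[of x] by (simp add: K add_pos_nonneg)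
    qed
    have supp': "supp (fun_of (test_deriv \<phi>)) \<subseteq> U"
      using supp supp_test_deriv[of \<phi>] \<phi> by auto
    have integrable: "integrable lborel (\<lambda>x. m * fun_of (test_deriv \<phi>) x)"
      "integrable lborel (\<lambda>x. H x * fun_of (test_deriv \<phi>) x)"
      by (intro integrable_times_test_fun[OF _ supp'] continuous_on_const assms(3))+
    have "(LINT x|lborel. K x) = m * (LINT x|lborel. fun_of (test_deriv \<phi>) x)
        - (LINT x|lborel. H x * fun_of (test_deriv \<phi>) x)"
      using integrable by (simp add: K_def left_diff_distrib)
    also have "\<dots> = 0"
      using int0[of \<phi>] supp \<phi> by (simp add: LINT_test_deriv)
    finally have "(LINT x|lborel. K x) = 0" .
    moreover have "integrable lborel K"
      unfolding K_def left_diff_distrib using integrable by (rule Bochner_Integration.integrable_diff)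
    moreover have "K x \<ge> 0" for x
      using K1[of x] K2[of x] by (simp add: K)
    \<comment> \<open>A nonnegative integrable function with integral \<open>0\<close> vanishes
      almost everywhere. Since \<open>K\<close> is positive on \<open>(c - e, c + e)\<close>, that
      interval would be a null set, but its length is \<open>2 * e\<close>.\<close>
    ultimately have "AE x in lborel. K x = 0"
      by (simp add: integral_nonneg_eq_0_iff_AE)
    then have "AE x in lborel. x \<notin> {c - e<..<c + e}"
      by eventually_elim (use K_pos in force)
    then have "emeasure lborel {c - e<..<c + e} = 0"
      by (subst (asm) AE_iff_measurable[of "{c - e<..<c + e}"]) auto
    then show False
      using e by simp
  qed
  then show ?thesis
    unfolding constant_on_def by (metis linorder_neqE)
qed

text \<open>Tested against \<open>\<phi>\<close>, equality of the derivatives says that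
  \<open>F - G\<close> integrates to \<open>0\<close> against \<open>\<phi>'\<close>, which is the
  hypothesis of \<open>du_Bois_Reymond\<close>.\<close>

lemma primitives_differ_by_constant:
  assumes "open U" "is_interval U" "continuous_on U F" "continuous_on U G"
    and "dist_eq_on U (dist_deriv (dist_of U F)) (dist_deriv (dist_of U G))"
  shows "(\<lambda>x. F x - G x) constant_on U"
proof (rule du_Bois_Reymond)
  fix \<phi> assume supp: "supp (fun_of \<phi>) \<subseteq> U"
  then have supp': "supp (fun_of (test_deriv \<phi>)) \<subseteq> U"
    using supp_test_deriv[of \<phi>] by auto
  have "dist_of U F (test_deriv \<phi>) = dist_of U G (test_deriv \<phi>)"
    using assms(5) supp by (simp add: dist_eq_on_def dist_deriv_def)
  then show "(LINT x|lborel. (F x - G x) * fun_of (test_deriv \<phi>) x) = 0"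
    using supp' assms(3,4)
    by (simp add: dist_of_eq_LINT left_diff_distrib integrable_times_test_fun)
qed (use assms in \<open>auto intro!: continuous_intros\<close>)

section \<open>Values of the two integrals\<close>

lemma integral_interval_eq:
  assumes "a < b" "continuous_on {a..b} F"
    and "dist_eq_on {a<..<b} f (dist_deriv (dist_of {a<..<b} F))"
  shows "integral_interval a b f = F b - F a"
  unfolding integral_interval_def
proof (rule the_equality)
  fix I assume "\<exists>G. continuous_on {a..b} G \<and>
    dist_eq_on {a<..<b} f (dist_deriv (dist_of {a<..<b} G)) \<and> I = G b - G a"
  then obtain G where G: "continuous_on {a..b} G"
    "dist_eq_on {a<..<b} f (dist_deriv (dist_of {a<..<b} G))" "I = G b - G a"
    by blast
  have "(\<lambda>x. F x - G x) constant_on {a<..<b}"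
  proof (rule primitives_differ_by_constant)
    show "dist_eq_on {a<..<b} (dist_deriv (dist_of {a<..<b} F)) (dist_deriv (dist_of {a<..<b} G))"
      using G(2) assms(3) by (simp add: dist_eq_on_def)
  qed (use G(1) assms(2) in \<open>auto simp: is_interval_1 intro: continuous_on_subset\<close>)
  then obtain k where "\<And>x. x \<in> {a<..<b} \<Longrightarrow> F x - G x = k"
    by (auto simp: constant_on_def)
  \<comment> \<open>Test functions supported in the open interval give \<open>F - G = k\<close> only
    there; continuity carries this to the endpoints, where the integral is read off.\<close>
  moreover have "continuous_on (closure {a<..<b}) (\<lambda>x. F x - G x)"
    using assms(1,2) G(1) by (auto intro!: continuous_intros)
  ultimately have "F x - G x = k" if "x \<in> {a..b}" for x
    using continuous_constant_on_closure[of "{a<..<b}" "\<lambda>x. F x - G x" k x] assms(1) that by simp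
  from this[of a] this[of b] show "I = F b - F a"
    using G(3) assms(1) by simp
qed (use assms in blast)

text \<open>Two primitives in \<open>B_C\<close> differ by a constant, and the common limit
  \<open>0\<close> at minus infinity forces it to be \<open>0\<close>.\<close>

lemma primitive_eq:
  assumes F: "F \<in> B_C" and f: "f = dist_deriv (dist_of UNIV F)"
  shows "primitive f = F"
  unfolding primitive_def
proof (rule the_equality)
  have bot: "(H \<longlongrightarrow> 0) at_bot" if "H \<in> B_C" for H
    using that by (auto simp: B_C_def C0_ext_def ext_val_def tendsto_Lim)
  fix G assume G: "G \<in> B_C \<and> f = dist_deriv (dist_of UNIV G)"
  then have "(\<lambda>x. F x - G x) constant_on UNIV"
    using F f by (intro primitives_differ_by_constant)
      (auto simp: B_C_def C0_ext_def C0_def dist_eq_on_def is_interval_1)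
  then obtain k where k: "\<And>x. F x - G x = k"
    by (auto simp: constant_on_def)
  have "((\<lambda>x. F x - G x) \<longlongrightarrow> 0 - 0) at_bot"
    using F G by (intro tendsto_diff bot) auto
  then have "k = 0"
    by (simp add: k tendsto_const_iff)
  then show "G = F"
    using k by (auto simp: fun_eq_iff)
qed (use assms in blast)

text \<open>Constants are annihilated because the derivative of a test function has integral
  \<open>0\<close>.\<close>

lemma dist_deriv_dist_of_minus_const:
  assumes "F \<in> C0"
  shows "dist_deriv (dist_of UNIV (\<lambda>x. F x - k)) = dist_deriv (dist_of UNIV F)"
proof
  fix \<phi>
  have "integrable lborel (\<lambda>x. G x * fun_of (test_deriv \<phi>) x)" if "continuous_on UNIV G" for G
    using that by (rule integrable_times_test_fun) simp
  from this[of F] this[of "\<lambda>_. k"] show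
    "dist_deriv (dist_of UNIV (\<lambda>x. F x - k)) \<phi> = dist_deriv (dist_of UNIV F) \<phi>"
    using assms by (simp add: dist_deriv_def dist_of_eq_LINT C0_def left_diff_distrib LINT_test_deriv)
qed

text \<open>A global primitive also serves on \<open>(a, b)\<close>: restricting it does not change
  its pairing with test functions supported there.\<close>

lemma integral_interval_dist_deriv:
  assumes "F \<in> C0" "a < b"
  shows "integral_interval a b (dist_deriv (dist_of UNIV F)) = F b - F a"
proof (rule integral_interval_eq[OF assms(2)])
  show "continuous_on {a..b} F"
    using assms(1) by (auto simp: C0_def intro: continuous_on_subset)
  show "dist_eq_on {a<..<b} (dist_deriv (dist_of UNIV F)) (dist_deriv (dist_of {a<..<b} F))"
    unfolding dist_eq_on_def dist_deriv_def
  proof (intro allI impI)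
    fix \<phi> assume "supp (fun_of \<phi>) \<subseteq> {a<..<b}"
    then have "supp (fun_of (test_deriv \<phi>)) \<subseteq> {a<..<b}"
      using supp_test_deriv[of \<phi>] by blast
    then show "- dist_of UNIV F (test_deriv \<phi>) = - dist_of {a<..<b} F (test_deriv \<phi>)"
      by (simp add: dist_of_eq_LINT)
  qed
qed

theorem theorem25:
  fixes f :: "test_fun \<Rightarrow> real" and F :: "real \<Rightarrow> real"
  assumes "f \<in> distributions"
    and "F \<in> C0"
    and "f = dist_deriv (dist_of UNIV F)"
    and "\<exists>l. (F \<longlongrightarrow> l) at_top"
    and "\<exists>l. (F \<longlongrightarrow> l) at_bot"
  shows "f \<in> A_C \<and>
    (\<exists>L1 L2. ((\<lambda>x. integral_interval 0 x f) \<longlongrightarrow> L1) at_top \<and>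
             ((\<lambda>x. integral_interval x 0 f) \<longlongrightarrow> L2) at_bot \<and>
             integral_line f = L1 + L2)"
proof -
  obtain l k where l: "(F \<longlongrightarrow> l) at_top" and k: "(F \<longlongrightarrow> k) at_bot"
    using assms(4,5) by blast
  \<comment> \<open>Shifting by the limit at minus infinity puts the primitive into
    \<open>B_C\<close> without changing its derivative.\<close>
  define G where "G = (\<lambda>x. F x - k)"
  have top: "(G \<longlongrightarrow> l - k) at_top" and bot: "(G \<longlongrightarrow> k - k) at_bot"
    unfolding G_def by (intro tendsto_intros l k)+
  have G: "G \<in> B_C"
    using assms(2) top bot
    by (auto simp: B_C_def C0_ext_def C0_def ext_val_def G_def tendsto_Lim intro!: continuous_intros)
  have fG: "f = dist_deriv (dist_of UNIV G)"
    using assms(2,3) by (simp add: G_def dist_deriv_dist_of_minus_const)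
  have "f \<in> A_C"
    using assms(1) G fG by (auto simp: A_C_def)
  \<comment> \<open>The value is \<open>G\<close> at infinity, namely \<open>l - k\<close>, split at
    \<open>F 0\<close> to match the two limits.\<close>
  moreover have "integral_line f = (l - F 0) + (F 0 - k)"
    using primitive_eq[OF G fG] top by (simp add: integral_line_def ext_val_def tendsto_Lim)
  moreover have "((\<lambda>x. integral_interval 0 x f) \<longlongrightarrow> l - F 0) at_top"
  proof (rule Lim_transform_eventually)
    show "((\<lambda>x. F x - F 0) \<longlongrightarrow> l - F 0) at_top"
      by (intro tendsto_intros l)
    \<comment> \<open>The formula is available only for \<open>0 < x\<close>, hence eventually; near
      minus infinity the condition is \<open>x < 0\<close>.\<close>
    show "\<forall>\<^sub>F x in at_top. F x - F 0 = integral_interval 0 x f"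
      using eventually_gt_at_top[of 0]
      by eventually_elim (simp add: assms(2,3) integral_interval_dist_deriv)
  qed
  moreover have "((\<lambda>x. integral_interval x 0 f) \<longlongrightarrow> F 0 - k) at_bot"
  proof (rule Lim_transform_eventually)
    show "((\<lambda>x. F 0 - F x) \<longlongrightarrow> F 0 - k) at_bot"
      by (intro tendsto_intros k)
    show "\<forall>\<^sub>F x in at_bot. F 0 - F x = integral_interval x 0 f"
      using eventually_gt_at_bot[of 0]
      by eventually_elim (simp add: assms(2,3) integral_interval_dist_deriv)
  qed
  ultimately show ?thesis
    by blast
qed

end
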